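(* For $u,v,n \in \mathbb{N}$, let $C_4(u,v,n)$ denote the number of partitions of $n$ into $u$ distinct parts congruent to $1$ modulo $4$ and $v$ distinct parts congruent to $3$ modulo $4$ (all parts distinct). Let $D_4(u,v,n)$ denote the number of partitions $\lambda_1 + \cdots + \lambda_s$ of $n$ (positive integer parts, $\lambda_1\ge\lambda_2\ge\cdots\ge\lambda_s$) such that $u$ equals the number of parts congruent to $0$ or $1$ modulo $4$ plus twice the number of parts congruent to $6$ modulo $8$, and $v$ equals the number of parts congruent to $0$ or $3$ modulo $4$ plus twice the number of parts congruent to $2$ modulo $8$, satisfying the following conditions: (1) for all $i$, $\lambda_i \neq 2$; (2) for all $1\le i<s$, $\lambda_i - \lambda_{i+1} \geq 5$; (3) for all $1\le i<s$: if $\lambda_i - \lambda_{i+1} = 5$ then $\lambda_i \equiv 1, 4 \pmod 8$; if $\lambda_i - \lambda_{i+1} = 6$ then $\lambda_i \equiv 1, 3, 5, 7 \pmod 8$; if $\lambda_i - \lambda_{i+1} = 7$ then $\lambda_i \equiv 0, 1, 3, 4, 6, 7 \pmod 8$; if $\lambda_i - \lambda_{i+1} = 8$ then $\lambda_i \equiv 0, 1, 3, 4, 5, 7 \pmod 8$. Then $C_4(u,v,n)=D_4(u,v,n)$ for all $u,v,n\in\mathbb{N}$. *)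

theory Defs
  imports Main
begin

text \<open>C_4(u,v,n): partitions of n into distinct parts, all congruent to 1 or 3 mod 4,
  with u parts congruent to 1 mod 4 and v parts congruent to 3 mod 4.
  A partition into distinct parts is represented by its finite set of parts.\<close>
definition C4 :: "nat \<Rightarrow> nat \<Rightarrow> nat \<Rightarrow> nat" where
  "C4 u v n = card {S :: nat set. finite S
      \<and> (\<forall>x\<in>S. x mod 4 = 1 \<or> x mod 4 = 3)
      \<and> \<Sum>S = n
      \<and> card {x\<in>S. x mod 4 = 1} = u
      \<and> card {x\<in>S. x mod 4 = 3} = v}"

definition gap_ok :: "nat \<Rightarrow> nat \<Rightarrow> bool" where
  "gap_ok a b \<longleftrightarrow> b + 5 \<le> a
     \<and> (a - b = 5 \<longrightarrow> a mod 8 \<in> {1, 4})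
     \<and> (a - b = 6 \<longrightarrow> a mod 8 \<in> {1, 3, 5, 7})
     \<and> (a - b = 7 \<longrightarrow> a mod 8 \<in> {0, 1, 3, 4, 6, 7})
     \<and> (a - b = 8 \<longrightarrow> a mod 8 \<in> {0, 1, 3, 4, 5, 7})"

definition D4 :: "nat \<Rightarrow> nat \<Rightarrow> nat \<Rightarrow> nat" where
  "D4 u v n = card {l :: nat list.
      (\<forall>x\<in>set l. 0 < x)
      \<and> sorted_wrt (\<ge>) l
      \<and> sum_list l = n
      \<and> u = length (filter (\<lambda>x. x mod 4 = 0 \<or> x mod 4 = 1) l)
            + 2 * length (filter (\<lambda>x. x mod 8 = 6) l)
      \<and> v = length (filter (\<lambda>x. x mod 4 = 0 \<or> x mod 4 = 3) l)
            + 2 * length (filter (\<lambda>x. x mod 8 = 2) l)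
      \<and> (\<forall>x\<in>set l. x \<noteq> 2)
      \<and> (\<forall>i. Suc i < length l \<longrightarrow> gap_ok (l ! i) (l ! Suc i))}"

end

(*
  Let P_N(a,b,q) be the generating function of the partitions counted by D_4 whose largest part
  is at most N, with a and b marking u and v.  Removing the largest part gives linear recurrences
  for P_N that depend on N mod 8, and by induction these yield

    P_{2j+4}(a,b,q) = (1 + a q) P_{2j+1}(b q^2, a q^2, q).

  The product (1 + a q)(1 + b q^3)(1 + a q^5)(1 + b q^7)... satisfies the same functional equation.
  Iterating t times leaves P_M with both marks divisible by q^(2t), which is 1 modulo q^(2t), so
  P_N and the product agree modulo any given power of q once N is large.
*)

theory Submission
  imports Defs "HOL-Computational_Algebra.Polynomial"
begin

section \<open>Weights of parts and partitions\<close>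

text \<open>The contribution of one part to \<open>u\<close> in \<open>D4\<close>;
  \<open>bcharge\<close> is its analogue for \<open>v\<close>. On odd parts both reduce to the
  counts in \<open>C4\<close>, so one weight serves both sides.\<close>

definition acharge :: "nat \<Rightarrow> nat" where
  "acharge m = of_bool (m mod 4 = 0 \<or> m mod 4 = 1) + 2 * of_bool (m mod 8 = 6)"

definition bcharge :: "nat \<Rightarrow> nat" where
  "bcharge m = of_bool (m mod 4 = 0 \<or> m mod 4 = 3) + 2 * of_bool (m mod 8 = 2)"

text \<open>The marks are arbitrary ring elements, since the functional equation replaces
  \<open>a\<close> and \<open>b\<close> by \<open>b * q ^ 2\<close> and \<open>a * q ^ 2\<close>;
  indeterminates are inserted only at the end.\<close>

definition part_weight :: "'a::comm_ring_1 \<Rightarrow> 'a \<Rightarrow> 'a \<Rightarrow> nat \<Rightarrow> 'a" where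
  "part_weight a b q m = a ^ acharge m * b ^ bcharge m * q ^ m"

definition weight :: "'a::comm_ring_1 \<Rightarrow> 'a \<Rightarrow> 'a \<Rightarrow> nat list \<Rightarrow> 'a" where
  "weight a b q l = prod_list (map (part_weight a b q) l)"

lemma weight_simps [simp]:
  "weight a b q [] = 1"
  "weight a b q (m # l) = part_weight a b q m * weight a b q l"
  by (simp_all add: weight_def)

lemma weight_eq:
  "weight a b q l = a ^ sum_list (map acharge l) * b ^ sum_list (map bcharge l) * q ^ sum_list l"
  by (induction l) (simp_all add: part_weight_def power_add algebra_simps)

section \<open>Gap partitions and their largest parts\<close>

definition gap_lists :: "nat list set" where
  "gap_lists = {l. (\<forall>x\<in>set l. 0 < x \<and> x \<noteq> 2) \<and> successively gap_ok l}"

definition lists_le :: "nat \<Rightarrow> nat list set" where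
  "lists_le N = {l \<in> gap_lists. l = [] \<or> hd l \<le> N}"

definition lists_hd :: "nat \<Rightarrow> nat list set" where
  "lists_hd m = {l \<in> gap_lists. l \<noteq> [] \<and> hd l = m}"

text \<open>The tails that may remain when a largest part \<open>m\<close> is removed.\<close>

definition successors :: "nat \<Rightarrow> nat list set" where
  "successors m = {l \<in> gap_lists. l = [] \<or> gap_ok m (hd l)}"

lemma gap_lists_Cons:
  "m # l \<in> gap_lists \<longleftrightarrow> 0 < m \<and> m \<noteq> 2 \<and> l \<in> successors m"
  by (cases l) (auto simp: gap_lists_def successors_def)

lemma Nil_in_gap_lists [simp]: "[] \<in> gap_lists"
  by (simp add: gap_lists_def)

lemma gap_lists_hd:
  assumes "l \<in> gap_lists" "l \<noteq> []"
  shows "0 < hd l" "hd l \<noteq> 2"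
  using assms by (auto simp: gap_lists_def)

lemma lists_hd_empty [simp]: "lists_hd 0 = {}" "lists_hd 2 = {}"
  by (auto simp: lists_hd_def dest: gap_lists_hd)

lemma lists_le_0 [simp]: "lists_le 0 = {[]}"
  by (auto simp: lists_le_def dest: gap_lists_hd)

lemma lists_le_Suc: "lists_le (Suc N) = lists_le N \<union> lists_hd (Suc N)"
  by (auto simp: lists_le_def lists_hd_def)

lemma lists_le_hd_disjoint: "N < m \<Longrightarrow> lists_le N \<inter> lists_hd m = {}"
  by (auto simp: lists_le_def lists_hd_def)

lemma lists_hd_eq:
  assumes "0 < m" "m \<noteq> 2"
  shows "lists_hd m = (#) m ` successors m"
proof (intro equalityI subsetI)
  fix l assume "l \<in> lists_hd m"
  then obtain l' where "l = m # l'" "m # l' \<in> gap_lists"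
    by (cases l) (auto simp: lists_hd_def)
  then show "l \<in> (#) m ` successors m"
    by (auto simp: gap_lists_Cons)
next
  fix l assume "l \<in> (#) m ` successors m"
  with assms show "l \<in> lists_hd m"
    by (auto simp: lists_hd_def gap_lists_Cons)
qed

lemma gap_ok_less: "gap_ok m h \<Longrightarrow> h < m"
  unfolding gap_ok_def by (drule conjunct1) simp

lemma successors_subset: "successors m \<subseteq> lists_le (m - 1)"
  by (auto simp: successors_def lists_le_def dest: gap_ok_less)

lemma finite_lists_le [simp]: "finite (lists_le N)"
proof (induction N)
  case (Suc N)
  have "finite (lists_hd (Suc N))"
  proof (cases "Suc N = 2")
    case False
    have "finite (successors (Suc N))"
      using successors_subset[of "Suc N"] Suc by (auto intro: finite_subset)
    with False show ?thesis by (simp add: lists_hd_eq)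
  qed (metis lists_hd_empty(2) finite.emptyI)
  with Suc show ?case by (simp add: lists_le_Suc)
qed simp

lemma finite_lists_hd [simp]: "finite (lists_hd m)"
  by (rule finite_subset[OF _ finite_lists_le[of m]]) (auto simp: lists_hd_def lists_le_def)

section \<open>The gap condition by residue modulo 8\<close>

text \<open>Writing each difference as an addition removes truncated subtraction. Gaps of 9 or more
  are unrestricted, so only the gaps 5 to 8 look at residues.\<close>

lemma gap_ok_cases:
  "gap_ok m h \<longleftrightarrow> m = h + 5 \<and> m mod 8 \<in> {1, 4}
     \<or> m = h + 6 \<and> m mod 8 \<in> {1, 3, 5, 7}
     \<or> m = h + 7 \<and> m mod 8 \<in> {0, 1, 3, 4, 6, 7}
     \<or> m = h + 8 \<and> m mod 8 \<in> {0, 1, 3, 4, 5, 7}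
     \<or> h + 9 \<le> m"
proof -
  have "m < h + 5 \<or> m = h + 5 \<or> m = h + 6 \<or> m = h + 7 \<or> m = h + 8 \<or> h + 9 \<le> m"
    by linarith
  then consider "m < h + 5" | d where "m = h + d" "d \<in> {5, 6, 7, 8}" | "h + 9 \<le> m"
    by blast
  then show ?thesis
  proof cases
    case 1
    then have "\<not> gap_ok m h" by (simp add: gap_ok_def)
    with 1 show ?thesis by simp
  next
    case 2
    then show ?thesis unfolding gap_ok_def by (elim insertE emptyE; simp)
  next
    case 3
    then have "m - h \<ge> 9" by simp
    then have "gap_ok m h" using 3 unfolding gap_ok_def by simp
    with 3 show ?thesis by blast
  qed
qed

text \<open>
  Truncated subtraction gives the right values for small \<open>m\<close>: \<open>h \<le> 0\<close> and \<open>h = 0\<close> exclude every part,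
  just as \<open>lists_le 0\<close> contains only the empty list and \<open>lists_hd 0\<close> is empty.
\<close>

lemma gap_ok_mod_8:
  assumes "0 < h"
  shows "m mod 8 = 0 \<Longrightarrow> gap_ok m h \<longleftrightarrow> h \<le> m - 7"
    "m mod 8 = 1 \<Longrightarrow> gap_ok m h \<longleftrightarrow> h \<le> m - 5"
    "m mod 8 = 2 \<Longrightarrow> gap_ok m h \<longleftrightarrow> h \<le> m - 9"
    "m mod 8 = 3 \<Longrightarrow> gap_ok m h \<longleftrightarrow> h \<le> m - 6"
    "m mod 8 = 4 \<Longrightarrow> gap_ok m h \<longleftrightarrow> h \<le> m - 7 \<or> h = m - 5"
    "m mod 8 = 5 \<Longrightarrow> gap_ok m h \<longleftrightarrow> h \<le> m - 8 \<or> h = m - 6"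
    "m mod 8 = 6 \<Longrightarrow> gap_ok m h \<longleftrightarrow> h \<le> m - 9 \<or> h = m - 7"
    "m mod 8 = 7 \<Longrightarrow> gap_ok m h \<longleftrightarrow> h \<le> m - 6"
  using assms by (simp_all only: gap_ok_cases) auto

lemma successors_eq_lists_le:
  assumes "\<And>h. 0 < h \<Longrightarrow> gap_ok m h \<longleftrightarrow> h \<le> N"
  shows "successors m = lists_le N"
  using assms by (auto simp: successors_def lists_le_def dest: gap_lists_hd)

lemma successors_eq_lists_le_hd:
  assumes "\<And>h. 0 < h \<Longrightarrow> gap_ok m h \<longleftrightarrow> h \<le> N \<or> h = K"
  shows "successors m = lists_le N \<union> lists_hd K"
  using assms by (auto simp: successors_def lists_le_def lists_hd_def dest: gap_lists_hd)

section \<open>Generating functions and their recurrences\<close>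

definition gf_le :: "'a::comm_ring_1 \<Rightarrow> 'a \<Rightarrow> 'a \<Rightarrow> nat \<Rightarrow> 'a" where
  "gf_le a b q N = (\<Sum>l\<in>lists_le N. weight a b q l)"

definition gf_hd :: "'a::comm_ring_1 \<Rightarrow> 'a \<Rightarrow> 'a \<Rightarrow> nat \<Rightarrow> 'a" where
  "gf_hd a b q m = (\<Sum>l\<in>lists_hd m. weight a b q l)"

lemma gf_le_0 [simp]: "gf_le a b q 0 = 1"
  by (simp add: gf_le_def)

lemma gf_le_Suc: "gf_le a b q (Suc N) = gf_le a b q N + gf_hd a b q (Suc N)"
  by (simp add: gf_le_def gf_hd_def lists_le_Suc sum.union_disjoint lists_le_hd_disjoint)

lemma gf_hd_0 [simp]: "gf_hd a b q 0 = 0" and gf_hd_2 [simp]: "gf_hd a b q 2 = 0"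
  by (simp_all add: gf_hd_def)

lemma gf_hd_eq:
  assumes "0 < m" "m \<noteq> 2"
  shows "gf_hd a b q m = part_weight a b q m * (\<Sum>l\<in>successors m. weight a b q l)"
  by (simp add: gf_hd_def lists_hd_eq[OF assms] sum.reindex sum_distrib_left)

lemma mod_4_eq: "(8 * k + r) mod 4 = r mod 4" for k r :: nat
  by presburger

lemma gf_hd_eq_le:
  assumes "0 < m" "m \<noteq> 2" "\<And>h. 0 < h \<Longrightarrow> gap_ok m h \<longleftrightarrow> h \<le> N"
  shows "gf_hd a b q m = part_weight a b q m * gf_le a b q N"
  using assms by (simp add: gf_hd_eq gf_le_def successors_eq_lists_le)

text \<open>Serves the residues 4, 5 and 6, where one isolated value \<open>K\<close> above the
  bound \<open>N\<close> may also follow \<open>m\<close>. The alternative \<open>K = 0\<close>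
  covers \<open>m < 8\<close>, where \<open>K\<close> arises by truncation and
  \<open>lists_hd 0\<close> is empty.\<close>

lemma gf_hd_eq_le_hd:
  assumes "0 < m" "m \<noteq> 2" "\<And>h. 0 < h \<Longrightarrow> gap_ok m h \<longleftrightarrow> h \<le> N \<or> h = K" "N < K \<or> K = 0"
  shows "gf_hd a b q m = part_weight a b q m * (gf_le a b q N + gf_hd a b q K)"
proof -
  have "lists_le N \<inter> lists_hd K = {}"
    using assms(4) lists_le_hd_disjoint by auto
  with assms show ?thesis
    by (simp add: gf_hd_eq[OF assms(1,2)] successors_eq_lists_le_hd[OF assms(3)] gf_le_def
        gf_hd_def[of a b q K] sum.union_disjoint)
qed

lemma part_weight_mod_8:
  "part_weight a b q (8 * k) = a * b * q ^ (8 * k)"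
  "part_weight a b q (8 * k + 1) = a * q ^ (8 * k + 1)"
  "part_weight a b q (8 * k + 2) = b ^ 2 * q ^ (8 * k + 2)"
  "part_weight a b q (8 * k + 3) = b * q ^ (8 * k + 3)"
  "part_weight a b q (8 * k + 4) = a * b * q ^ (8 * k + 4)"
  "part_weight a b q (8 * k + 5) = a * q ^ (8 * k + 5)"
  "part_weight a b q (8 * k + 6) = a ^ 2 * q ^ (8 * k + 6)"
  "part_weight a b q (8 * k + 7) = b * q ^ (8 * k + 7)"
  using mod_4_eq[of k 0]
  by (simp_all only: part_weight_def acharge_def bcharge_def mod_4_eq mod_mult_self4)
    (simp_all add: power2_eq_square)

text \<open>Removal of the largest part. The condition \<open>0 < k\<close> keeps out 0 and 2, which
  are not allowed as parts. The residues 4, 5 and 6 leave the same tails: largest part at most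
  \<open>8 * k - 3\<close> or equal to \<open>8 * k - 1\<close>.\<close>

lemma gf_hd_mod_8:
  "0 < k \<Longrightarrow> gf_hd a b q (8 * k) = a * b * q ^ (8 * k) * gf_le a b q (8 * k - 7)"
  "gf_hd a b q (8 * k + 1) = a * q ^ (8 * k + 1) * gf_le a b q (8 * k - 4)"
  "0 < k \<Longrightarrow> gf_hd a b q (8 * k + 2) = b ^ 2 * q ^ (8 * k + 2) * gf_le a b q (8 * k - 7)"
  "gf_hd a b q (8 * k + 3) = b * q ^ (8 * k + 3) * gf_le a b q (8 * k - 3)"
  "gf_hd a b q (8 * k + 4) = a * b * q ^ (8 * k + 4) * (gf_le a b q (8 * k - 3) + gf_hd a b q (8 * k - 1))"
  "gf_hd a b q (8 * k + 5) = a * q ^ (8 * k + 5) * (gf_le a b q (8 * k - 3) + gf_hd a b q (8 * k - 1))"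
  "gf_hd a b q (8 * k + 6) = a ^ 2 * q ^ (8 * k + 6) * (gf_le a b q (8 * k - 3) + gf_hd a b q (8 * k - 1))"
  "gf_hd a b q (8 * k + 7) = b * q ^ (8 * k + 7) * gf_le a b q (8 * k + 1)"
proof -
  show "gf_hd a b q (8 * k) = a * b * q ^ (8 * k) * gf_le a b q (8 * k - 7)" if "0 < k"
    unfolding part_weight_mod_8[of a b q k, symmetric]
    by (rule gf_hd_eq_le) (use that in \<open>simp_all add: gap_ok_mod_8\<close>)
  show "gf_hd a b q (8 * k + 1) = a * q ^ (8 * k + 1) * gf_le a b q (8 * k - 4)"
    unfolding part_weight_mod_8[of a b q k, symmetric]
    by (rule gf_hd_eq_le) (simp_all add: gap_ok_mod_8)
  show "gf_hd a b q (8 * k + 2) = b ^ 2 * q ^ (8 * k + 2) * gf_le a b q (8 * k - 7)" if "0 < k"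
    unfolding part_weight_mod_8[of a b q k, symmetric]
    by (rule gf_hd_eq_le) (use that in \<open>simp_all add: gap_ok_mod_8 del: add_2_eq_Suc'\<close>)
  show "gf_hd a b q (8 * k + 3) = b * q ^ (8 * k + 3) * gf_le a b q (8 * k - 3)"
    unfolding part_weight_mod_8[of a b q k, symmetric]
    by (rule gf_hd_eq_le) (simp_all add: gap_ok_mod_8)
  show "gf_hd a b q (8 * k + 4) = a * b * q ^ (8 * k + 4) * (gf_le a b q (8 * k - 3) + gf_hd a b q (8 * k - 1))"
    unfolding part_weight_mod_8[of a b q k, symmetric]
    by (rule gf_hd_eq_le_hd) (auto simp: gap_ok_mod_8)
  show "gf_hd a b q (8 * k + 5) = a * q ^ (8 * k + 5) * (gf_le a b q (8 * k - 3) + gf_hd a b q (8 * k - 1))"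
    unfolding part_weight_mod_8[of a b q k, symmetric]
    by (rule gf_hd_eq_le_hd) (auto simp: gap_ok_mod_8)
  show "gf_hd a b q (8 * k + 6) = a ^ 2 * q ^ (8 * k + 6) * (gf_le a b q (8 * k - 3) + gf_hd a b q (8 * k - 1))"
    unfolding part_weight_mod_8[of a b q k, symmetric]
    by (rule gf_hd_eq_le_hd) (auto simp: gap_ok_mod_8)
  show "gf_hd a b q (8 * k + 7) = b * q ^ (8 * k + 7) * gf_le a b q (8 * k + 1)"
    unfolding part_weight_mod_8[of a b q k, symmetric]
    by (rule gf_hd_eq_le) (simp_all add: gap_ok_mod_8)
qed

lemma gf_le_numeral:
  "gf_le a b q (n + numeral r) = gf_le a b q (n + pred_numeral r) + gf_hd a b q (n + numeral r)"
  using gf_le_Suc[of a b q "n + pred_numeral r"] by (simp add: numeral_eq_Suc)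

text \<open>The recurrences at \<open>k + 1\<close> and \<open>k + 2\<close>, where no subtraction
  remains, in the form used by the induction on \<open>k\<close>.\<close>

lemma gf_hd_shifted:
  "gf_hd a b q (8 * k + 8) = a * b * q ^ (8 * k + 8) * gf_le a b q (8 * k + 1)"
  "gf_hd a b q (8 * k + 9) = a * q ^ (8 * k + 9) * gf_le a b q (8 * k + 4)"
  "gf_hd a b q (8 * k + 10) = b ^ 2 * q ^ (8 * k + 10) * gf_le a b q (8 * k + 1)"
  "gf_hd a b q (8 * k + 11) = b * q ^ (8 * k + 11) * gf_le a b q (8 * k + 5)"
  "gf_hd a b q (8 * k + 12) = a * b * q ^ (8 * k + 12) * (gf_le a b q (8 * k + 5) + gf_hd a b q (8 * k + 7))"
  "gf_hd a b q (8 * k + 13) = a * q ^ (8 * k + 13) * (gf_le a b q (8 * k + 5) + gf_hd a b q (8 * k + 7))"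
  "gf_hd a b q (8 * k + 14) = a ^ 2 * q ^ (8 * k + 14) * (gf_le a b q (8 * k + 5) + gf_hd a b q (8 * k + 7))"
  "gf_hd a b q (8 * k + 15) = b * q ^ (8 * k + 15) * gf_le a b q (8 * k + 9)"
  "gf_hd a b q (8 * k + 16) = a * b * q ^ (8 * k + 16) * gf_le a b q (8 * k + 9)"
  "gf_hd a b q (8 * k + 17) = a * q ^ (8 * k + 17) * gf_le a b q (8 * k + 12)"
  "gf_hd a b q (8 * k + 18) = b ^ 2 * q ^ (8 * k + 18) * gf_le a b q (8 * k + 9)"
  using gf_hd_mod_8[where k = "k + 1" and a = a and b = b and q = q]
    gf_hd_mod_8(1-3)[where k = "k + 2" and a = a and b = b and q = q]
  by (simp_all add: add.commute)

section \<open>The functional equation\<close>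

text \<open>
  The first four conjuncts are the functional equation. The others make the induction close: some
  recurrences involve a single \<open>gf_hd\<close>, for which no relation follows from the functional equation.
\<close>

lemma gf_le_shift_mod_8:
  fixes a b q :: "'a::comm_ring_1"
  defines "s \<equiv> 1 + a * q"
    and "p \<equiv> gf_le a b q" and "p' \<equiv> gf_le (b * q\<^sup>2) (a * q\<^sup>2) q"
    and "e \<equiv> gf_hd a b q" and "e' \<equiv> gf_hd (b * q\<^sup>2) (a * q\<^sup>2) q"
  shows "s * p' (8 * k + 1) = p (8 * k + 4) \<and> s * p' (8 * k + 3) = p (8 * k + 6)
    \<and> s * p' (8 * k + 5) = p (8 * k + 8) \<and> s * p' (8 * k + 7) = p (8 * k + 10)
    \<and> s * e' (8 * k + 4) = e (8 * k + 8) \<and> s * e' (8 * k + 7) = e (8 * k + 9)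
    \<and> e (8 * k + 6) + e (8 * k + 8) = a * q * (e (8 * k + 5) + e (8 * k + 7))"
proof (induction k)
  case 0
  \<comment> \<open>At \<open>k = 0\<close> the truncated arguments become 0, where
    \<open>gf_le\<close> is 1 and \<open>gf_hd\<close> is 0.\<close>
  have small: "gf_hd a b q 1 = a * q" "gf_hd a b q 3 = b * q ^ 3" "gf_hd a b q 4 = a * b * q ^ 4"
    "gf_hd a b q 5 = a * q ^ 5" "gf_hd a b q 6 = a\<^sup>2 * q ^ 6" "gf_hd a b q 7 = b * q ^ 7 * gf_le a b q 1"
    for a b q :: 'a
    using gf_hd_mod_8[where k = 0 and a = a and b = b and q = q] by simp_all
  have P: "gf_le a b q 1 = 1 + gf_hd a b q 1" "gf_le a b q 3 = gf_le a b q 1 + gf_hd a b q 3"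
    "gf_le a b q 4 = gf_le a b q 3 + gf_hd a b q 4"
    "gf_le a b q 5 = gf_le a b q 3 + gf_hd a b q 4 + gf_hd a b q 5"
    "gf_le a b q 6 = gf_le a b q 4 + gf_hd a b q 5 + gf_hd a b q 6"
    "gf_le a b q 7 = gf_le a b q 5 + gf_hd a b q 6 + gf_hd a b q 7"
    "gf_le a b q 8 = gf_le a b q 6 + gf_hd a b q 7 + gf_hd a b q 8"
    "gf_le a b q 10 = gf_le a b q 8 + gf_hd a b q 9 + gf_hd a b q 10" for a b q :: 'a
    using gf_le_Suc[of a b q 0] gf_le_numeral[of a b q 0]
    by (simp_all add: add_ac)
  have P1: "p 1 = s" "p' 1 = 1 + b * q ^ 3"
    unfolding p_def p'_def s_def P small by (simp_all add: power_numeral_reduce mult_ac)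
  have e: "e 7 = b * q ^ 7 * s" "e 8 = a * b * q ^ 8 * s" "e 9 = a * q ^ 9 * p 4"
    "e 10 = b\<^sup>2 * q ^ 10 * s"
    using gf_hd_shifted(1-3)[where k = 0 and a = a and b = b and q = q] small(6)[of a b q]
    by (simp_all add: p_def e_def P1(1)[unfolded p_def One_nat_def])
  have s1: "s * p' 1 = p 4"
    unfolding P1 p_def P small by (simp add: s_def power_numeral_reduce algebra_simps)
  \<comment> \<open>The factor \<open>1 + a * q\<close> splits the weight \<open>a * q ^ 5\<close>
    of the part 3 under the swapped marks into the weights of the parts 5 and 6.\<close>
  have s3: "s * p' 3 = s * p' 1 + e 5 + e 6"
    unfolding p'_def e_def P small by (simp add: s_def power_numeral_reduce algebra_simps)
  \<comment> \<open>Multiplication by \<open>s\<close> carries the largest parts 4, 5, 6, 7 under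
    the swapped marks to 8, 7, 10, 9. The order changes within each pair, so only the sums over
    pairs match.\<close>
  have e4: "s * e' 4 = e 8"
    unfolding e'_def e small by (simp add: power_numeral_reduce mult_ac)
  have e5: "s * e' 5 = e 7"
    unfolding e'_def e small by (simp add: power_numeral_reduce mult_ac)
  have e6: "s * e' 6 = e 10"
    unfolding e'_def e small by (simp add: power_numeral_reduce mult_ac)
  have e7: "s * e' 7 = e 9"
    unfolding e s1[symmetric] e'_def p'_def small(6) by (simp add: power_numeral_reduce mult_ac)
  have s5: "s * p' 5 = s * p' 3 + s * e' 4 + s * e' 5"
    unfolding p'_def e'_def P by (simp add: algebra_simps)
  have s7: "s * p' 7 = s * p' 5 + s * e' 6 + s * e' 7"
    unfolding p'_def e'_def P by (simp add: algebra_simps)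
  have p6: "p 6 = p 4 + e 5 + e 6" and p8: "p 8 = p 6 + e 7 + e 8" and p10: "p 10 = p 8 + e 9 + e 10"
    unfolding p_def e_def P by simp_all
  have "e 6 + e 8 = a * q * (e 5 + e 7)"
    unfolding e unfolding e_def small by (simp add: power_numeral_reduce algebra_simps)
  then show ?case
    using s1 s3 s5 s7 e4 e5 e6 e7 p6 p8 p10 by (simp add: add_ac)
next
  case (Suc k)
  \<comment> \<open>With \<open>z\<close> split off, all remaining exponents are numerals and the
    identities below are plain algebra.\<close>
  define z where "z = q ^ (8 * k)"
  have step: "p (8 * k + 5) = p (8 * k + 4) + e (8 * k + 5)"
    "p (8 * k + 6) = p (8 * k + 5) + e (8 * k + 6)"
    "p (8 * k + 8) = p (8 * k + 6) + e (8 * k + 7) + e (8 * k + 8)"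
    "p (8 * k + 9) = p (8 * k + 8) + e (8 * k + 9)"
    "p (8 * k + 12) = p (8 * k + 10) + e (8 * k + 11) + e (8 * k + 12)"
    "p (8 * k + 14) = p (8 * k + 12) + e (8 * k + 13) + e (8 * k + 14)"
    "p (8 * k + 16) = p (8 * k + 14) + e (8 * k + 15) + e (8 * k + 16)"
    "p (8 * k + 18) = p (8 * k + 16) + e (8 * k + 17) + e (8 * k + 18)"
    by (simp_all add: p_def e_def gf_le_numeral)
  have step': "p' (8 * k + 4) = p' (8 * k + 3) + e' (8 * k + 4)"
    "p' (8 * k + 9) = p' (8 * k + 7) + e' (8 * k + 8) + e' (8 * k + 9)"
    "p' (8 * k + 11) = p' (8 * k + 9) + e' (8 * k + 10) + e' (8 * k + 11)"
    "p' (8 * k + 13) = p' (8 * k + 11) + e' (8 * k + 12) + e' (8 * k + 13)"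
    "p' (8 * k + 15) = p' (8 * k + 13) + e' (8 * k + 14) + e' (8 * k + 15)"
    by (simp_all add: p'_def e'_def gf_le_numeral)
  have e: "e (8 * k + 11) = b * q ^ 11 * z * p (8 * k + 5)"
    "e (8 * k + 12) = a * b * q ^ 12 * z * (p (8 * k + 5) + e (8 * k + 7))"
    "e (8 * k + 13) = a * q ^ 13 * z * (p (8 * k + 5) + e (8 * k + 7))"
    "e (8 * k + 14) = a\<^sup>2 * q ^ 14 * z * (p (8 * k + 5) + e (8 * k + 7))"
    "e (8 * k + 15) = b * q ^ 15 * z * p (8 * k + 9)"
    "e (8 * k + 16) = a * b * q ^ 16 * z * p (8 * k + 9)"
    "e (8 * k + 17) = a * q ^ 17 * z * p (8 * k + 12)"
    "e (8 * k + 18) = b\<^sup>2 * q ^ 18 * z * p (8 * k + 9)"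
    unfolding e_def p_def z_def gf_hd_shifted by (simp_all add: power_add mult_ac)
  have e': "e' (8 * k + 8) = a * b * q ^ 12 * z * p' (8 * k + 1)"
    "e' (8 * k + 9) = b * q ^ 11 * z * p' (8 * k + 4)"
    "e' (8 * k + 10) = a\<^sup>2 * q ^ 14 * z * p' (8 * k + 1)"
    "e' (8 * k + 11) = a * q ^ 13 * z * p' (8 * k + 5)"
    "e' (8 * k + 12) = a * b * q ^ 16 * z * (p' (8 * k + 5) + e' (8 * k + 7))"
    "e' (8 * k + 13) = b * q ^ 15 * z * (p' (8 * k + 5) + e' (8 * k + 7))"
    "e' (8 * k + 14) = b\<^sup>2 * q ^ 18 * z * (p' (8 * k + 5) + e' (8 * k + 7))"
    "e' (8 * k + 15) = a * q ^ 17 * z * p' (8 * k + 9)"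
    unfolding e'_def p'_def z_def gf_hd_shifted by (simp_all add: power_add power_numeral_reduce mult_ac)
  have s1: "s * p' (8 * k + 1) = p (8 * k + 4)" and s3: "s * p' (8 * k + 3) = p (8 * k + 6)"
    and s5: "s * p' (8 * k + 5) = p (8 * k + 8)" and s7: "s * p' (8 * k + 7) = p (8 * k + 10)"
    and s4: "s * e' (8 * k + 4) = e (8 * k + 8)" and se7: "s * e' (8 * k + 7) = e (8 * k + 9)"
    and e68: "e (8 * k + 6) + e (8 * k + 8) = a * q * (e (8 * k + 5) + e (8 * k + 7))"
    using Suc.IH by auto
  \<comment> \<open>The last induction hypothesis rewrites \<open>p (8 * k + 8)\<close> through the
    bracket \<open>p (8 * k + 5) + e (8 * k + 7)\<close> that occurs in
    \<open>e (8 * k + 12)\<close> to \<open>e (8 * k + 14)\<close>.\<close>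
  have p8: "p (8 * k + 8) = (1 + a * q) * (p (8 * k + 5) + e (8 * k + 7)) - a * q * p (8 * k + 4)"
  proof -
    have "p (8 * k + 8) = p (8 * k + 5) + e (8 * k + 7) + (e (8 * k + 6) + e (8 * k + 8))"
      unfolding step by (simp add: add_ac)
    also have "\<dots> = (1 + a * q) * (p (8 * k + 5) + e (8 * k + 7)) - a * q * p (8 * k + 4)"
      unfolding e68 step(1) by (simp add: algebra_simps)
    finally show ?thesis .
  qed
  \<comment> \<open>The recurrence for \<open>e' (8 * k + 9)\<close> involves an even index of
    \<open>p'\<close>, outside the functional equation; the hypothesis on
    \<open>e' (8 * k + 4)\<close> supplies it.\<close>
  have sp4: "s * p' (8 * k + 4) = p (8 * k + 8) - e (8 * k + 7)"
    unfolding step'(1) step(3) distrib_left s3 s4 by simp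
  have s57: "s * (p' (8 * k + 5) + e' (8 * k + 7)) = p (8 * k + 9)"
    unfolding step(4) distrib_left s5 se7 ..
  have s9: "s * p' (8 * k + 9) = p (8 * k + 12)"
  proof -
    have "s * p' (8 * k + 9) = s * p' (8 * k + 7) + a * b * q ^ 12 * z * (s * p' (8 * k + 1))
        + b * q ^ 11 * z * (s * p' (8 * k + 4))"
      unfolding step'(2) e' by (simp add: algebra_simps)
    \<comment> \<open>After substitution of \<open>p8\<close> the two terms in
      \<open>p (8 * k + 4)\<close> cancel, and likewise in \<open>s11\<close>.\<close>
    also have "\<dots> = p (8 * k + 12)"
      unfolding sp4 p8 s1 s7 step(5) e by (simp add: algebra_simps power_numeral_reduce)
    finally show ?thesis .
  qed
  have s11: "s * p' (8 * k + 11) = p (8 * k + 14)"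
  proof -
    have "s * p' (8 * k + 11) = s * p' (8 * k + 9) + a\<^sup>2 * q ^ 14 * z * (s * p' (8 * k + 1))
        + a * q ^ 13 * z * (s * p' (8 * k + 5))"
      unfolding step'(3) e' by (simp add: algebra_simps)
    also have "\<dots> = p (8 * k + 14)"
      unfolding s9 s1 s5 p8 step(6) e by (simp add: algebra_simps power_numeral_reduce)
    finally show ?thesis .
  qed
  have se12: "s * e' (8 * k + 12) = e (8 * k + 16)" and se13: "s * e' (8 * k + 13) = e (8 * k + 15)"
    and se14: "s * e' (8 * k + 14) = e (8 * k + 18)"
    unfolding e e' s57[symmetric] by (simp_all add: mult_ac)
  have se15: "s * e' (8 * k + 15) = e (8 * k + 17)"
    unfolding e e' s9[symmetric] by (simp add: mult_ac)
  have s13: "s * p' (8 * k + 13) = p (8 * k + 16)"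
    unfolding step'(4) step(7) using s11 se12 se13 by (simp add: distrib_left)
  have s15: "s * p' (8 * k + 15) = p (8 * k + 18)"
    unfolding step'(5) step(8) using s13 se14 se15 by (simp add: distrib_left)
  \<comment> \<open>This holds term by term: 13 and 14 leave the same tails, as do 15 and 16, and
    each pair of weights differs by the factor \<open>a * q\<close>.\<close>
  have e14: "e (8 * k + 14) + e (8 * k + 16) = a * q * (e (8 * k + 13) + e (8 * k + 15))"
    unfolding e by (simp add: algebra_simps power_numeral_reduce)
  show ?case
    using s9 s11 s13 s15 se12 se15 e14 by (simp add: add.commute)
qed

text \<open>Every odd number is \<open>8 * k + r\<close> with \<open>r\<close> among 1, 3, 5, 7, so
  the first four conjuncts above cover all \<open>j\<close>.\<close>

lemma gf_le_shift:
  "gf_le a b q (2 * j + 4) = (1 + a * q) * gf_le (b * q\<^sup>2) (a * q\<^sup>2) q (2 * j + 1)"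
proof -
  define k where "k = j div 4"
  have "j mod 4 < 4" "j = 4 * k + j mod 4"
    by (simp_all add: k_def)
  then have "j = 4 * k \<or> j = 4 * k + 1 \<or> j = 4 * k + 2 \<or> j = 4 * k + 3"
    by linarith
  then have "\<exists>r\<in>{1, 3, 5, 7}. 2 * j + 1 = 8 * k + r"
    by (elim disjE) simp_all
  then obtain r where r: "r \<in> {1, 3, 5, 7}" "2 * j + 1 = 8 * k + r"
    by blast
  then have r3: "2 * j + 4 = 8 * k + (r + 3)"
    by linarith
  show ?thesis
    unfolding r(2) r3 using gf_le_shift_mod_8[of a q b k] r(1)
    by (elim insertE emptyE) simp_all
qed

section \<open>Congruence with the product modulo powers of q\<close>

lemma dvd_gf_hd:
  assumes "x dvd part_weight a b q m"
  shows "x dvd gf_hd a b q m"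
proof (cases "m = 0 \<or> m = 2")
  case True
  then show ?thesis by auto
next
  case False
  with assms show ?thesis by (simp add: gf_hd_eq)
qed

text \<open>Every residue class carries at least one mark, so no part has a bare power of
  \<open>q\<close> as its weight.\<close>

lemma dvd_part_weight:
  assumes "x dvd a" "x dvd b"
  shows "x dvd part_weight a b q m"
proof -
  define k where "k = m div 8"
  have "m mod 8 < 8" "m = 8 * k + m mod 8" by (simp_all add: k_def)
  then consider "m = 8 * k" | "m = 8 * k + 1" | "m = 8 * k + 2" | "m = 8 * k + 3"
    | "m = 8 * k + 4" | "m = 8 * k + 5" | "m = 8 * k + 6" | "m = 8 * k + 7"
    by linarith
  then show ?thesis
    by cases (use assms in \<open>simp_all only: part_weight_mod_8 power2_eq_square dvd_mult2\<close>)
qed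

text \<open>The difference is the sum of \<open>gf_hd a b q m\<close> over
  \<open>N < m \<le> M\<close>, and each summand has the factor \<open>part_weight a b q m\<close>
  or vanishes.\<close>

lemma dvd_gf_le_diff:
  assumes "N \<le> M" "\<And>m. N < m \<Longrightarrow> x dvd part_weight a b q m"
  shows "x dvd gf_le a b q M - gf_le a b q N"
  using assms(1)
proof (induction M rule: dec_induct)
  case (step M)
  then have "x dvd gf_le a b q M - gf_le a b q N + gf_hd a b q (Suc M)"
    using assms(2) by (intro dvd_add dvd_gf_hd) auto
  then show ?case by (simp add: gf_le_Suc algebra_simps)
qed simp

text \<open>Adding 2 exchanges the residues 1 and 3 modulo 4, which matches the swap of marks; the
  factor \<open>q ^ 2\<close> accounts for the larger part.\<close>

lemma odd_part_weight_shift: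
  assumes "odd x"
  shows "part_weight (b * q\<^sup>2) (a * q\<^sup>2) q x = part_weight a b q (x + 2)"
proof -
  have "\<exists>k. x = 8 * k + 1 \<or> x = 8 * k + 3 \<or> x = 8 * k + 5 \<or> x = 8 * k + 7"
    using assms by presburger
  then obtain k where "x = 8 * k + 1 \<or> x = 8 * k + 3 \<or> x = 8 * k + 5 \<or> x = 8 * k + 7" ..
  then consider "x = 8 * k + 1" "x + 2 = 8 * k + 3" | "x = 8 * k + 3" "x + 2 = 8 * k + 5"
    | "x = 8 * k + 5" "x + 2 = 8 * k + 7" | "x = 8 * k + 7" "x + 2 = 8 * (k + 1) + 1"
    by fastforce
  then show ?thesis
    by cases (simp_all only: part_weight_mod_8, simp_all add: power_add power_numeral_reduce mult_ac)
qed

definition odd_prod :: "'a::comm_ring_1 \<Rightarrow> 'a \<Rightarrow> 'a \<Rightarrow> nat \<Rightarrow> 'a" where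
  "odd_prod a b q t = (\<Prod>i<t. 1 + part_weight a b q (2 * i + 1))"

lemma odd_prod_Suc:
  "odd_prod a b q (Suc t) = (1 + a * q) * odd_prod (b * q\<^sup>2) (a * q\<^sup>2) q t"
proof -
  have "part_weight a b q 1 = a * q"
    using part_weight_mod_8(2)[of a b q 0] by simp
  moreover have "part_weight (b * q\<^sup>2) (a * q\<^sup>2) q (2 * i + 1) = part_weight a b q (2 * Suc i + 1)" for i
    by (subst odd_part_weight_shift) simp_all
  ultimately show ?thesis
    unfolding odd_prod_def by (simp only: prod.lessThan_Suc_shift) simp
qed

text \<open>The exponent \<open>c\<close> records the power of \<open>q\<close> dividing both marks.
  Each use of the functional equation raises \<open>c\<close> by 2 and removes one factor of the
  product. At \<open>t = 0\<close> the marks vanish modulo \<open>q ^ K\<close>, and both sides are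
  1.\<close>

lemma gf_le_cong_odd_prod_aux:
  assumes "q ^ c dvd a" "q ^ c dvd b" "K \<le> c + 2 * t" "K + 4 * t \<le> N"
  shows "q ^ K dvd gf_le a b q N - odd_prod a b q t"
  using assms
proof (induction t arbitrary: a b c N)
  case 0
  then have "q ^ K dvd a" "q ^ K dvd b"
    by (auto intro: dvd_trans[OF le_imp_power_dvd])
  then have "q ^ K dvd gf_le a b q N - gf_le a b q 0"
    by (intro dvd_gf_le_diff dvd_part_weight) auto
  then show ?case by (simp add: odd_prod_def)
next
  case (Suc t)
  \<comment> \<open>Rounding \<open>N\<close> down to an even index costs at most 1 and passing to
    \<open>2 * j + 1\<close> costs 3, hence the term \<open>4 * t\<close> in the bound on
    \<open>N\<close>.\<close>
  define j where "j = (N - 4) div 2"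
  have j: "2 * j + 4 \<le> N" "K + 4 * t \<le> 2 * j + 1"
    using Suc.prems(4) unfolding j_def by auto
  \<comment> \<open>Any part above \<open>2 * j + 4\<close> exceeds \<open>K\<close>, so its own
    power of \<open>q\<close> suffices.\<close>
  have "q ^ K dvd gf_le a b q N - gf_le a b q (2 * j + 4)"
    using j by (intro dvd_gf_le_diff) (auto simp: part_weight_def intro!: dvd_mult le_imp_power_dvd)
  moreover have "q ^ K dvd (1 + a * q) * (gf_le (b * q\<^sup>2) (a * q\<^sup>2) q (2 * j + 1)
      - odd_prod (b * q\<^sup>2) (a * q\<^sup>2) q t)"
  proof (rule dvd_mult, rule Suc.IH[of "c + 2"])
    show "q ^ (c + 2) dvd b * q\<^sup>2" "q ^ (c + 2) dvd a * q\<^sup>2"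
      unfolding power_add using Suc.prems by (simp_all add: mult_dvd_mono)
  qed (use Suc.prems j in simp_all)
  ultimately have "q ^ K dvd (gf_le a b q N - gf_le a b q (2 * j + 4))
      + (1 + a * q) * (gf_le (b * q\<^sup>2) (a * q\<^sup>2) q (2 * j + 1) - odd_prod (b * q\<^sup>2) (a * q\<^sup>2) q t)"
    by (rule dvd_add)
  then show ?case
    by (simp add: gf_le_shift odd_prod_Suc right_diff_distrib)
qed

lemma gf_le_cong_odd_prod:
  assumes "K \<le> 2 * t" "K + 4 * t \<le> N"
  shows "q ^ K dvd gf_le a b q N - odd_prod a b q t"
  using gf_le_cong_odd_prod_aux[of q 0 a b K t N] assms by simp

section \<open>The product as a sum over sets of odd parts\<close>

definition odds :: "nat \<Rightarrow> nat set" where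
  "odds t = (\<lambda>i. 2 * i + 1) ` {..<t}"

lemma finite_odds [simp]: "finite (odds t)"
  by (simp add: odds_def)

lemma mem_odds_iff: "x \<in> odds t \<longleftrightarrow> odd x \<and> x < 2 * t"
  by (auto simp: odds_def image_iff elim!: oddE)

lemma odd_charges:
  assumes "odd x"
  shows "acharge x = of_bool (x mod 4 = 1)" "bcharge x = of_bool (x mod 4 = 3)"
proof -
  have "x mod 4 \<noteq> 0" "x mod 8 \<noteq> 2" "x mod 8 \<noteq> 6"
    using assms by presburger+
  then show "acharge x = of_bool (x mod 4 = 1)" "bcharge x = of_bool (x mod 4 = 3)"
    by (simp_all add: acharge_def bcharge_def)
qed

text \<open>Expanding the product chooses 1 or the weight in each factor, that is, a set of distinct
  odd parts.\<close>

lemma odd_prod_eq_sum: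
  "odd_prod a b q t =
     (\<Sum>S\<in>Pow (odds t). a ^ card {x\<in>S. x mod 4 = 1} * b ^ card {x\<in>S. x mod 4 = 3} * q ^ \<Sum>S)"
proof -
  have "odd_prod a b q t = (\<Prod>x\<in>odds t. part_weight a b q x + 1)"
    unfolding odd_prod_def odds_def by (subst prod.reindex) (auto simp: inj_on_def add.commute)
  also have "\<dots> = (\<Sum>S\<in>Pow (odds t). \<Prod>x\<in>S. part_weight a b q x)"
    by (subst prod_add) simp_all
  also have "\<dots> = (\<Sum>S\<in>Pow (odds t).
      a ^ card {x\<in>S. x mod 4 = 1} * b ^ card {x\<in>S. x mod 4 = 3} * q ^ \<Sum>S)"
  proof (rule sum.cong)
    fix S assume "S \<in> Pow (odds t)"
    then have S: "finite S" "\<And>x. x \<in> S \<Longrightarrow> odd x"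
      by (auto simp: mem_odds_iff intro: finite_subset[OF _ finite_odds])
    have "sum acharge S = card {x\<in>S. x mod 4 = 1}" "sum bcharge S = card {x\<in>S. x mod 4 = 3}"
      using S by (simp_all add: odd_charges Int_def cong: sum.cong)
    then show "(\<Prod>x\<in>S. part_weight a b q x)
        = a ^ card {x\<in>S. x mod 4 = 1} * b ^ card {x\<in>S. x mod 4 = 3} * q ^ \<Sum>S"
      by (simp add: part_weight_def prod.distrib flip: power_sum)
  qed simp
  finally show ?thesis .
qed

lemma sum_list_charges:
  "sum_list (map acharge l) = length (filter (\<lambda>x. x mod 4 = 0 \<or> x mod 4 = 1) l)
     + 2 * length (filter (\<lambda>x. x mod 8 = 6) l)"
  "sum_list (map bcharge l) = length (filter (\<lambda>x. x mod 4 = 0 \<or> x mod 4 = 3) l)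
     + 2 * length (filter (\<lambda>x. x mod 8 = 2) l)"
  by (induction l) (simp_all add: acharge_def bcharge_def)

section \<open>Extraction of coefficients\<close>

text \<open>Independent indeterminates in nested polynomials: \<open>q\<close> outermost, then
  \<open>b\<close>, then \<open>a\<close>. Polynomials are enough because both sides are finite
  truncations compared modulo a power of \<open>q\<close>.\<close>

definition var_a :: "int poly poly poly" where "var_a = [:[:monom 1 1:]:]"
definition var_b :: "int poly poly poly" where "var_b = [:monom 1 1:]"
definition var_q :: "int poly poly poly" where "var_q = monom 1 1"

definition coeff3 :: "nat \<Rightarrow> nat \<Rightarrow> nat \<Rightarrow> int poly poly poly \<Rightarrow> int" where
  "coeff3 u v n p = coeff (coeff (coeff p n) v) u"

lemma coeff3_monomial:
  "coeff3 u v n (var_a ^ u' * var_b ^ v' * var_q ^ n') = of_bool (u' = u \<and> v' = v \<and> n' = n)"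
proof -
  have "var_a ^ u' * var_b ^ v' * var_q ^ n' = monom (monom (monom 1 u') v') n'"
    by (simp add: var_a_def var_b_def var_q_def poly_const_pow monom_power smult_monom)
  then show ?thesis
    by (simp add: coeff3_def)
qed

lemma coeff3_sum:
  assumes "finite A"
  shows "coeff3 u v n (\<Sum>x\<in>A. var_a ^ f x * var_b ^ g x * var_q ^ h x)
    = int (card {x\<in>A. f x = u \<and> g x = v \<and> h x = n})"
proof -
  have "coeff3 u v n (\<Sum>x\<in>A. var_a ^ f x * var_b ^ g x * var_q ^ h x)
      = (\<Sum>x\<in>A. coeff3 u v n (var_a ^ f x * var_b ^ g x * var_q ^ h x))"
    by (simp add: coeff3_def coeff_sum)
  then show ?thesis
    using assms by (simp add: coeff3_monomial Int_def)
qed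

text \<open>A multiple of \<open>var_q ^ Suc n\<close> has no term of degree \<open>n\<close> in
  \<open>q\<close>.\<close>

lemma coeff3_eq_if_dvd_diff:
  assumes "var_q ^ Suc n dvd x - y"
  shows "coeff3 u v n x = coeff3 u v n y"
proof -
  obtain z where "x - y = var_q ^ Suc n * z"
    using assms by (elim dvdE)
  then have "coeff (x - y) n = 0"
    by (simp add: var_q_def monom_power coeff_monom_mult del: power_Suc)
  then show ?thesis
    by (simp add: coeff3_def)
qed

text \<open>The largest part is at most the sum \<open>n\<close>, so the bound \<open>N\<close>
  excludes none of the counted partitions.\<close>

lemma D4_eq_coeff3:
  assumes "n \<le> N"
  shows "int (D4 u v n) = coeff3 u v n (gf_le var_a var_b var_q N)"
proof -
  have gap: "(\<forall>i. Suc i < length l \<longrightarrow> gap_ok (l ! i) (l ! Suc i)) \<longleftrightarrow> successively gap_ok l" for l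
    by (simp add: successively_conv_nth)
  \<comment> \<open>Gaps of at least 5 make the list decreasing.\<close>
  have sorted: "sorted_wrt (\<ge>) l" if "successively gap_ok l" for l
  proof -
    have "successively (\<ge>) l"
      using that by (rule successively_mono) (simp add: gap_ok_less less_imp_le)
    moreover have "transp ((\<ge>) :: nat \<Rightarrow> nat \<Rightarrow> bool)"
      by (rule transpI) linarith
    ultimately show ?thesis
      by (simp add: successively_conv_sorted_wrt)
  qed
  have "l = [] \<or> hd l \<le> N" if "sum_list l = n" for l :: "nat list"
    using that assms by (cases l) auto
  then have "D4 u v n = card {l \<in> lists_le N. sum_list (map acharge l) = u
      \<and> sum_list (map bcharge l) = v \<and> sum_list l = n}"
    unfolding D4_def gap lists_le_def gap_lists_def mem_Collect_eq
      sum_list_charges(1)[symmetric] sum_list_charges(2)[symmetric]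
    by (intro arg_cong[where f = card] Collect_cong) (use sorted in blast)
  then show ?thesis
    by (simp add: gf_le_def weight_eq coeff3_sum)
qed

text \<open>Each part is at most \<open>n < 2 * t\<close>, so every counted set lies in
  \<open>odds t\<close>.\<close>

lemma C4_eq_coeff3:
  assumes "n < 2 * t"
  shows "int (C4 u v n) = coeff3 u v n (odd_prod var_a var_b var_q t)"
proof -
  have odd_iff: "odd x \<longleftrightarrow> x mod 4 = 1 \<or> x mod 4 = 3" for x :: nat
    by presburger
  have "S \<subseteq> odds t" if "finite S" "\<forall>x\<in>S. odd x" "\<Sum>S = n" for S :: "nat set"
  proof
    fix x assume "x \<in> S"
    with that have "x \<le> \<Sum>S"
      by (intro member_le_sum) auto
    with \<open>x \<in> S\<close> that assms show "x \<in> odds t"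
      by (simp add: mem_odds_iff)
  qed
  moreover have "finite S \<and> (\<forall>x\<in>S. odd x)" if "S \<subseteq> odds t" for S
    using that finite_subset[OF that finite_odds] by (auto simp: mem_odds_iff)
  ultimately have *: "finite S \<and> (\<forall>x\<in>S. odd x) \<and> \<Sum>S = n \<longleftrightarrow> S \<subseteq> odds t \<and> \<Sum>S = n" for S
    by metis
  have "C4 u v n = card {S \<in> Pow (odds t). card {x\<in>S. x mod 4 = 1} = u
      \<and> card {x\<in>S. x mod 4 = 3} = v \<and> \<Sum>S = n}"
    unfolding C4_def Pow_iff odd_iff[symmetric]
  proof (intro arg_cong[where f = card] Collect_cong)
    fix S :: "nat set"
    show "(finite S \<and> (\<forall>x\<in>S. odd x) \<and> \<Sum>S = n \<and> card {x\<in>S. x mod 4 = 1} = u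
        \<and> card {x\<in>S. x mod 4 = 3} = v)
      = (S \<subseteq> odds t \<and> card {x\<in>S. x mod 4 = 1} = u \<and> card {x\<in>S. x mod 4 = 3} = v \<and> \<Sum>S = n)"
      using *[of S] by argo
  qed
  then show ?thesis
    by (simp add: odd_prod_eq_sum coeff3_sum)
qed

theorem theorem1p8:
  fixes u v n :: nat
  shows "C4 u v n = D4 u v n"
proof -
  \<comment> \<open>The congruence is used with \<open>K = t = Suc n\<close>: its bound
    \<open>K + 4 * t\<close> is then \<open>5 * Suc n\<close>, and \<open>K \<le> 2 * t\<close> and
    \<open>n < 2 * t\<close> hold.\<close>
  have "coeff3 u v n (gf_le var_a var_b var_q (5 * Suc n))
      = coeff3 u v n (odd_prod var_a var_b var_q (Suc n))"
    by (intro coeff3_eq_if_dvd_diff gf_le_cong_odd_prod) auto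
  then have "int (D4 u v n) = int (C4 u v n)"
    using D4_eq_coeff3[of n "5 * Suc n" u v] C4_eq_coeff3[of n "Suc n" u v] by simp
  then show ?thesis by simp
qed

end
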